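(* Let $n\ge1$ and let $G=\mathrm{Aut}_0(\mathbb D^n)=S_n\mathbb T^n\subset\mathrm{GL}(n,\mathbb C)$. For every $v\in\mathbb C^n$, $$\widehat{Gv}=\{z\in\mathbb C^n:\ \mu_k(z)\le\mu_k(v),\ k=1,\dots,n\},$$ where $$\mu_k(z)=\max\{|z_{\sigma(1)}\cdots z_{\sigma(k)}|:\ \sigma\in S_n\}.$$
   Context: $\mathbb D$ is the open unit disc in $\mathbb C$; $\mathrm{Aut}_0(\mathbb D^n)$ is the group of linear automorphisms of the polydisc $\mathbb D^n$. $S_n$ acts on $\mathbb C^n$ by permutations of coordinates and $\mathbb T^n$ is the torus of diagonal unitary matrices. The polynomial hull of a compact $Q\subset\mathbb C^n$ is $\widehat Q=\{z\in\mathbb C^n:|p(z)|\le\sup_Q|p|\text{ for all holomorphic polynomials }p\}$. *)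

theory Defs
  imports "HOL-Analysis.Analysis" "HOL-Combinatorics.Permutations"
begin

definition polydisc :: "(complex ^ 'n) set" where
  "polydisc = {z. \<forall>i. cmod (z $ i) < 1}"

definition Aut0_polydisc :: "(complex ^ 'n ^ 'n) set" where
  "Aut0_polydisc = {A. invertible A \<and> (\<lambda>z. A *v z) ` polydisc = polydisc}"

text \<open>The matrix of \<open>\<sigma>\<close> maps the basis vector \<open>axis j 1\<close> to \<open>axis (\<sigma> j) 1\<close>.\<close>

definition permutation_matrices :: "(complex ^ 'n ^ 'n) set" where
  "permutation_matrices =
     {(\<chi> i j. if i = \<sigma> j then 1 else 0) | \<sigma>. \<sigma> permutes UNIV}"

definition unitary_torus :: "(complex ^ 'n ^ 'n) set" where
  "unitary_torus =
     {(\<chi> i j. if i = j then t i else 0) | t. \<forall>i. cmod (t i) = 1}"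

text \<open>A multi-index is a function \<open>'n \<Rightarrow> nat\<close>; a polynomial is a finite linear
  combination of the corresponding monomials.\<close>

definition holomorphic_polynomial :: "(complex ^ 'n \<Rightarrow> complex) \<Rightarrow> bool" where
  "holomorphic_polynomial p \<longleftrightarrow>
     (\<exists>(A :: ('n \<Rightarrow> nat) set) c. finite A \<and>
        p = (\<lambda>z. \<Sum>\<alpha>\<in>A. c \<alpha> * (\<Prod>i\<in>UNIV. z $ i ^ \<alpha> i)))"

text \<open>The real-valued supremum is meaningful for nonempty compact \<open>Q\<close>, which is the
  intended use.\<close>

definition polynomial_hull :: "(complex ^ 'n) set \<Rightarrow> (complex ^ 'n) set" where
  "polynomial_hull Q =
     {z. \<forall>p. holomorphic_polynomial p \<longrightarrow> cmod (p z) \<le> (SUP w\<in>Q. cmod (p w))}"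

text \<open>The index type \<open>'n\<close> carries no numbering, so \<open>\<sigma> \<in> S\<^sub>n\<close> is rendered as
  a bijection from \<open>{1..n}\<close> onto \<open>'n\<close>, made extensional so that there are exactly
  \<open>n!\<close> of them and the maximum below is over a finite nonempty set.
  Only \<open>1 \<le> k \<le> n\<close> is meaningful.\<close>

definition enumerations :: "(nat \<Rightarrow> 'n::finite) set" where
  "enumerations =
     {\<sigma> \<in> {1..CARD('n)} \<rightarrow>\<^sub>E UNIV. bij_betw \<sigma> {1..CARD('n)} UNIV}"

definition mu :: "nat \<Rightarrow> complex ^ 'n \<Rightarrow> real" where
  "mu k z = Max ((\<lambda>\<sigma>. cmod (\<Prod>i=1..k. z $ \<sigma> i)) ` enumerations)"

end

theory Submission
  imports Defs
begin

text \<open>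
  An automorphism has row sums at most 1 in modulus, and each of its columns contains an entry of
  modulus at least 1, because a basis vector is not in the open polydisc; hence it is monomial.

  For the hull, the functions \<open>z\<^bsub>\<sigma>(1)\<^esub> \<cdots> z\<^bsub>\<sigma>(k)\<^esub>\<close> are polynomials, which gives one inclusion. Conversely, let
  \<open>\<mu>\<^sub>k(z) \<le> \<mu>\<^sub>k(v)\<close> for all \<open>k\<close>. Writing a monomial \<open>z\<^sup>\<alpha>\<close> as the product over the heights \<open>t\<close> of the
  coordinates in the superlevel set \<open>{i. t \<le> \<alpha> i}\<close> shows \<open>|z\<^sup>\<alpha>| \<le> |w\<^sup>\<alpha>|\<close>, where \<open>w\<close> is the permutation
  of \<open>v\<close> whose moduli are ordered like \<open>\<alpha>\<close>. If \<open>|p| \<le> M\<close> on the orbit, the Cauchy estimates on the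
  tori of the orbit bound every term of \<open>p\<^sup>m\<close> at \<open>z\<close> by \<open>M\<^sup>m\<close>. The number of terms grows only
  polynomially in \<open>m\<close>, so taking \<open>m\<close>-th roots gives \<open>|p(z)| \<le> M\<close>.
\<close>

section \<open>Polynomials on tori\<close>

definition monomial_at :: "('n::finite \<Rightarrow> nat) \<Rightarrow> complex ^ 'n \<Rightarrow> complex" where
  "monomial_at \<alpha> z = (\<Prod>i\<in>UNIV. z $ i ^ \<alpha> i)"

text \<open>Bounding each exponent separately, not the total degree, makes the number of exponents
  an exact power and sends box \<open>d\<close> to box \<open>d * m\<close> under
  \<open>m\<close>-th powers.\<close>

definition exponent_box :: "nat \<Rightarrow> ('n::finite \<Rightarrow> nat) set" where
  "exponent_box N = {\<alpha>. \<forall>i. \<alpha> i \<le> N}"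

lemma exponent_box_eq_PiE: "exponent_box N = UNIV \<rightarrow>\<^sub>E {..N}"
  by (auto simp: exponent_box_def)

lemma finite_exponent_box [simp]: "finite (exponent_box N :: ('n::finite \<Rightarrow> nat) set)"
  unfolding exponent_box_eq_PiE by (intro finite_PiE) auto

lemma card_exponent_box: "card (exponent_box N :: ('n::finite \<Rightarrow> nat) set) = Suc N ^ CARD('n)"
  unfolding exponent_box_eq_PiE by (simp add: card_funcsetE)

lemma finite_subset_exponent_box:
  assumes "finite (A :: ('n::finite \<Rightarrow> nat) set)"
  obtains d where "A \<subseteq> exponent_box d"
proof
  show "A \<subseteq> exponent_box (\<Sum>\<alpha>\<in>A. \<Sum>i\<in>UNIV. \<alpha> i)"
  proof (clarsimp simp: exponent_box_def)
    fix \<alpha> i assume "\<alpha> \<in> A"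
    have "\<alpha> i \<le> (\<Sum>i\<in>UNIV. \<alpha> i)" by (intro member_le_sum) auto
    also have "\<dots> \<le> (\<Sum>\<alpha>\<in>A. \<Sum>i\<in>UNIV. \<alpha> i)"
      using \<open>\<alpha> \<in> A\<close> assms by (intro member_le_sum[where f = "\<lambda>\<alpha>. \<Sum>i\<in>UNIV. \<alpha> i"]) auto
    finally show "\<alpha> i \<le> (\<Sum>\<alpha>\<in>A. \<Sum>i\<in>UNIV. \<alpha> i)" .
  qed
qed

lemma monomial_at_add: "monomial_at (\<lambda>i. \<alpha> i + \<beta> i) z = monomial_at \<alpha> z * monomial_at \<beta> z"
  by (simp add: monomial_at_def power_add prod.distrib)

lemma norm_monomial_at: "cmod (monomial_at \<alpha> z) = (\<Prod>i\<in>UNIV. cmod (z $ i) ^ \<alpha> i)"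
  by (simp add: monomial_at_def norm_power flip: prod_norm)

text \<open>The coefficients \<open>c'\<close> are chosen before the point \<open>z\<close>, so the
  same expansion of the \<open>m\<close>-th power serves on the orbit, where it is bounded, and at
  the point to be estimated.\<close>

lemma power_polynomial_box:
  fixes A :: "('n::finite \<Rightarrow> nat) set"
  assumes "finite A" "A \<subseteq> exponent_box d"
  shows "\<exists>c'. \<forall>z. (\<Sum>\<alpha>\<in>A. c \<alpha> * monomial_at \<alpha> z) ^ m
                = (\<Sum>\<alpha>\<in>exponent_box (d * m). c' \<alpha> * monomial_at \<alpha> z)"
proof (induction m)
  case 0
  have "exponent_box 0 = {\<lambda>i::'n. 0::nat}" by (auto simp: exponent_box_def)
  then show ?case by (intro exI[of _ "\<lambda>_. 1"]) (simp add: monomial_at_def)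
next
  case (Suc m)
  then obtain c' where c': "\<And>z. (\<Sum>\<alpha>\<in>A. c \<alpha> * monomial_at \<alpha> z) ^ m
      = (\<Sum>\<alpha>\<in>exponent_box (d * m). c' \<alpha> * monomial_at \<alpha> z)" by blast
  let ?S = "A \<times> exponent_box (d * m)"
  let ?g = "\<lambda>(\<alpha>, \<beta>) i. (\<alpha> i + \<beta> i :: nat)"
  let ?h = "\<lambda>z (\<alpha>, \<beta>). c \<alpha> * monomial_at \<alpha> z * (c' \<beta> * monomial_at \<beta> z)"
  \<comment> \<open>Convolution of the coefficients: pairs of exponents are grouped by their
    sum.\<close>
  let ?c = "\<lambda>\<gamma>. \<Sum>(\<alpha>, \<beta>)\<in>{x \<in> ?S. ?g x = \<gamma>}. c \<alpha> * c' \<beta>"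
  have g: "?g ` ?S \<subseteq> exponent_box (d * Suc m)"
    using assms(2) by (fastforce simp: exponent_box_def intro!: add_mono)
  have "(\<Sum>\<alpha>\<in>A. c \<alpha> * monomial_at \<alpha> z) ^ Suc m
      = (\<Sum>\<gamma>\<in>exponent_box (d * Suc m). ?c \<gamma> * monomial_at \<gamma> z)" for z
  proof -
    have "(\<Sum>\<alpha>\<in>A. c \<alpha> * monomial_at \<alpha> z) ^ Suc m = sum (?h z) ?S"
      by (simp add: c' sum_product sum.cartesian_product)
    also have "\<dots> = (\<Sum>\<gamma>\<in>exponent_box (d * Suc m). sum (?h z) {x \<in> ?S. ?g x = \<gamma>})"
      using g assms(1) by (intro sum.group[symmetric]) auto
    also have "\<dots> = (\<Sum>\<gamma>\<in>exponent_box (d * Suc m). ?c \<gamma> * monomial_at \<gamma> z)"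
      unfolding sum_distrib_right
      by (intro sum.cong refl) (auto simp: monomial_at_add mult_ac)
    finally show ?thesis .
  qed
  then show ?case by (intro exI[of _ ?c]) blast
qed

text \<open>Discrete orthogonality of characters, standing in for integration over the circle. Both
  exponents lie below \<open>N\<close>, which rules out distinct exponents congruent modulo
  \<open>N\<close>.\<close>

lemma sum_root_unity_powers:
  fixes a b N :: nat
  defines "\<omega> \<equiv> cis (2 * pi / real N)"
  assumes "a < N" "b < N"
  shows "(\<Sum>k<N. (\<omega> ^ b * cnj \<omega> ^ a) ^ k) = (if a = b then of_nat N else 0)"
proof -
  have cnj: "cnj \<omega> ^ j * \<omega> ^ j = 1" for j
    by (simp add: \<omega>_def cis_cnj cis_mult flip: power_mult_distrib)
  show ?thesis
  proof (cases "a = b")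
    case True
    then show ?thesis using cnj by (simp add: mult.commute)
  next
    case False
    have N: "N > 0" using assms by simp
    have pow: "\<omega> ^ j = cis (2 * pi * real j / real N)" for j
      by (simp add: \<omega>_def Complex.DeMoivre mult_ac)
    have "inj_on (\<lambda>k. cis (2 * pi * real k / real N)) {..<N}"
      using Complex.bij_betw_roots_unity[OF N] by (simp add: bij_betw_def)
    then have "\<omega> ^ a \<noteq> \<omega> ^ b"
      using False assms(2,3) unfolding pow by (auto dest: inj_onD)
    moreover have "\<omega> ^ b * cnj \<omega> ^ a * \<omega> ^ a = \<omega> ^ b" using cnj[of a] by (simp add: mult.assoc)
    ultimately have ne: "\<omega> ^ b * cnj \<omega> ^ a \<noteq> 1" by (metis mult_1)
    \<comment> \<open>The ratio differs from 1 but its \<open>N\<close>-th power is 1, so the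
      geometric sum vanishes.\<close>
    have wN: "\<omega> ^ N = 1" using N by (simp add: pow)
    then have "cnj \<omega> ^ N = 1" using cnj[of N] by simp
    then have "(\<omega> ^ b * cnj \<omega> ^ a) ^ N = 1"
      using wN by (metis mult_1 power_mult power_mult_distrib power_one mult.commute)
    then show ?thesis using False ne by (simp add: geometric_sum)
  qed
qed

text \<open>A Cauchy estimate with a finite average: summing the polynomial over a grid of
  \<open>N ^ CARD('n)\<close> points of the torus through \<open>w\<close>, against the conjugate
  character of \<open>\<alpha>\<close>, isolates the term of \<open>\<alpha>\<close>. Each summand
  has modulus at most \<open>B\<close>.\<close>

lemma torus_Cauchy_estimate:
  fixes A :: "('n::finite \<Rightarrow> nat) set" and w :: "complex ^ 'n"
  assumes fin: "finite A" and \<alpha>: "\<alpha> \<in> A"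
    and bound: "\<And>t. (\<And>i. cmod (t i) = 1) \<Longrightarrow>
                  cmod (\<Sum>\<beta>\<in>A. c \<beta> * monomial_at \<beta> (\<chi> i. t i * w $ i)) \<le> B"
  shows "cmod (c \<alpha> * monomial_at \<alpha> w) \<le> B"
proof -
  obtain d where "A \<subseteq> exponent_box d" using finite_subset_exponent_box[OF fin] .
  then have less: "\<beta> i < Suc d" if "\<beta> \<in> A" for \<beta> i
    using that by (auto simp: exponent_box_def less_Suc_eq_le)
  \<comment> \<open>The grid must be finer than every exponent occurring in \<open>A\<close> for
    orthogonality to apply.\<close>
  define N where "N = Suc d"
  define \<omega> where "\<omega> = cis (2 * pi / real N)"
  define K where "K = (UNIV \<rightarrow>\<^sub>E {..<N} :: ('n \<Rightarrow> nat) set)"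
  define f where "f z = (\<Sum>\<beta>\<in>A. c \<beta> * monomial_at \<beta> z)" for z
  have finK: "finite K" unfolding K_def by (intro finite_PiE) auto
  have cardK: "card K = N ^ CARD('n)" unfolding K_def by (simp add: card_funcsetE)
  have nw: "cmod \<omega> = 1" by (simp add: \<omega>_def)
  have "(\<Sum>k\<in>K. f (\<chi> i. \<omega> ^ k i * w $ i) * (\<Prod>i\<in>UNIV. cnj \<omega> ^ (k i * \<alpha> i)))
     = (\<Sum>k\<in>K. \<Sum>\<beta>\<in>A. c \<beta> * monomial_at \<beta> w * (\<Prod>i\<in>UNIV. (\<omega> ^ \<beta> i * cnj \<omega> ^ \<alpha> i) ^ k i))"
    unfolding f_def sum_distrib_right
    by (intro sum.cong refl)
       (simp add: monomial_at_def power_mult_distrib prod.distrib mult_ac flip: power_mult)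
  also have "\<dots> = (\<Sum>\<beta>\<in>A. c \<beta> * monomial_at \<beta> w * (\<Sum>k\<in>K. \<Prod>i\<in>UNIV. (\<omega> ^ \<beta> i * cnj \<omega> ^ \<alpha> i) ^ k i))"
    by (subst sum.swap) (simp add: sum_distrib_left)
  \<comment> \<open>The sum over the grid of a product over coordinates factors into one-variable
    sums.\<close>
  also have "\<dots> = (\<Sum>\<beta>\<in>A. c \<beta> * monomial_at \<beta> w *
      (\<Prod>i\<in>UNIV. \<Sum>k<N. (\<omega> ^ \<beta> i * cnj \<omega> ^ \<alpha> i) ^ k))"
    unfolding K_def by (subst prod_sum_PiE) auto
  also have "\<dots> = (\<Sum>\<beta>\<in>A. c \<beta> * monomial_at \<beta> w *
      (\<Prod>i\<in>UNIV. if \<alpha> i = \<beta> i then of_nat N else 0))"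
    unfolding \<omega>_def using less \<alpha>
    by (intro sum.cong arg_cong2[where f = "(*)"] prod.cong sum_root_unity_powers refl) (auto simp: N_def)
  also have "\<dots> = (\<Sum>\<beta>\<in>A. if \<beta> = \<alpha> then c \<alpha> * monomial_at \<alpha> w * of_nat N ^ CARD('n) else 0)"
  proof (intro sum.cong refl)
    fix \<beta>
    show "c \<beta> * monomial_at \<beta> w * (\<Prod>i\<in>UNIV. if \<alpha> i = \<beta> i then of_nat N else 0) =
      (if \<beta> = \<alpha> then c \<alpha> * monomial_at \<alpha> w * of_nat N ^ CARD('n) else 0)"
    proof (cases "\<beta> = \<alpha>")
      case False
      \<comment> \<open>One coordinate where the exponents differ makes the whole product
        zero.\<close>
      then obtain i where "\<alpha> i \<noteq> \<beta> i" by (metis ext)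
      then have "(\<Prod>i\<in>UNIV. if \<alpha> i = \<beta> i then of_nat N else 0 :: complex) = 0"
        by (intro prod_zero) auto
      then show ?thesis using False by simp
    qed simp
  qed
  also have "\<dots> = c \<alpha> * monomial_at \<alpha> w * of_nat N ^ CARD('n)"
    using fin \<alpha> by simp
  finally have eq: "c \<alpha> * monomial_at \<alpha> w * of_nat N ^ CARD('n) =
     (\<Sum>k\<in>K. f (\<chi> i. \<omega> ^ k i * w $ i) * (\<Prod>i\<in>UNIV. cnj \<omega> ^ (k i * \<alpha> i)))" by simp
  have "cmod (c \<alpha> * monomial_at \<alpha> w) * real N ^ CARD('n)
      = cmod (\<Sum>k\<in>K. f (\<chi> i. \<omega> ^ k i * w $ i) * (\<Prod>i\<in>UNIV. cnj \<omega> ^ (k i * \<alpha> i)))"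
    by (simp add: norm_mult norm_power flip: eq)
  also have "\<dots> \<le> (\<Sum>k\<in>K. cmod (f (\<chi> i. \<omega> ^ k i * w $ i) * (\<Prod>i\<in>UNIV. cnj \<omega> ^ (k i * \<alpha> i))))"
    by (rule norm_sum)
  also have "\<dots> = (\<Sum>k\<in>K. cmod (f (\<chi> i. \<omega> ^ k i * w $ i)))"
    by (simp add: norm_mult norm_power nw flip: prod_norm)
  also have "\<dots> \<le> (\<Sum>k\<in>K. B)"
    unfolding f_def by (intro sum_mono bound) (simp add: norm_power nw)
  also have "\<dots> = B * real N ^ CARD('n)" by (simp add: cardK)
  finally show ?thesis by (simp add: N_def)
qed

lemma le_of_power_le_polynomial_mult_power:
  fixes x M :: real and d n :: nat
  assumes M: "M \<ge> 0" and le: "\<And>m. x ^ m \<le> real (Suc (d * m)) ^ n * M ^ m"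
  shows "x \<le> M"
proof (rule ccontr)
  assume "\<not> x \<le> M"
  then have xM: "M < x" by simp
  show False
  proof (cases "M = 0 \<or> n = 0")
    \<comment> \<open>The case \<open>m = 1\<close> already contradicts \<open>M < x\<close>: the
      bound is 0 if \<open>M = 0\<close>, and \<open>M\<close> if \<open>n = 0\<close>.\<close>
    case True
    then show False using le[of 1] xM by auto
  next
    case False
    \<comment> \<open>Taking the \<open>n\<close>-th root reduces the comparison to linear growth
      \<open>d * m + 1\<close> against the exponential \<open>s ^ m\<close>.\<close>
    define s where "s = root n (x / M)"
    have s: "s > 1" "s ^ n = x / M"
      using False xM M by (auto simp: s_def)
    have "(\<lambda>m. real m / s ^ m) \<longlonglongrightarrow> 0" using lim_n_over_pown[of s] s by simp
    moreover have "(\<lambda>m. (1 / s) ^ m) \<longlonglongrightarrow> 0" using s by (intro LIMSEQ_power_zero) (auto simp: field_simps)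
    ultimately have "(\<lambda>m. real d * (real m / s ^ m) + (1 / s) ^ m) \<longlonglongrightarrow> real d * 0 + 0"
      by (intro tendsto_add tendsto_mult_left)
    then have "\<forall>\<^sub>F m in sequentially. real d * (real m / s ^ m) + (1 / s) ^ m < 1"
      by (intro order_tendstoD) auto
    then obtain m where "real d * (real m / s ^ m) + (1 / s) ^ m < 1"
      by (auto simp: eventually_sequentially)
    then have "real (Suc (d * m)) < s ^ m"
      using s by (simp add: power_divide field_simps split: if_splits)
    then have "real (Suc (d * m)) ^ n < (s ^ m) ^ n"
      using False by (intro power_strict_mono) auto
    also have "\<dots> = (x / M) ^ m" by (metis power_mult mult.commute s(2))
    finally have "real (Suc (d * m)) ^ n * M ^ m < x ^ m"
      using False M by (simp add: power_divide field_simps)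
    then show False using le[of m] by simp
  qed
qed

section \<open>Rearrangements and monomials\<close>

lemma finite_enumerations [simp]: "finite (enumerations :: (nat \<Rightarrow> 'n::finite) set)"
proof (rule finite_subset)
  show "enumerations \<subseteq> ({1..CARD('n)} \<rightarrow>\<^sub>E UNIV :: (nat \<Rightarrow> 'n) set)"
    by (auto simp: enumerations_def)
qed (intro finite_PiE, auto)

lemma enumerationsD:
  assumes "(e :: nat \<Rightarrow> 'n::finite) \<in> enumerations"
  shows "bij_betw e {1..CARD('n)} UNIV"
  using assms by (simp add: enumerations_def)

text \<open>Stated for any linear order because it sorts both the natural exponents of a monomial
  and the real moduli of the coordinates of \<open>v\<close>.\<close>

lemma descending_enumeration:
  fixes h :: "'n::finite \<Rightarrow> 'a::linorder"
  obtains e where "e \<in> enumerations"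
    "\<And>i j. 1 \<le> i \<Longrightarrow> i \<le> j \<Longrightarrow> j \<le> CARD('n) \<Longrightarrow> h (e j) \<le> h (e i)"
proof -
  obtain ys :: "'n list" where ys: "set ys = UNIV" "distinct ys"
    using finite_distinct_list[of "UNIV :: 'n set"] by auto
  define xs where "xs = rev (sort_key h ys)"
  have xs: "set xs = UNIV" "distinct xs" by (simp_all add: xs_def ys)
  have len: "length xs = CARD('n)" using xs distinct_card by fastforce
  have sorted: "sorted (rev (map h xs))" by (simp add: xs_def rev_map)
  \<comment> \<open>The shift passes from list positions starting at 0 to indices starting at 1;
    \<open>restrict\<close> gives the extensionality demanded by
    \<open>enumerations\<close>.\<close>
  define e where "e = restrict (\<lambda>i. xs ! (i - 1)) {1..CARD('n)}"
  have "bij_betw (\<lambda>i::nat. i - 1) {1..CARD('n)} {..<CARD('n)}"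
    by (rule bij_betw_byWitness[where f' = Suc]) auto
  then have "bij_betw ((!) xs \<circ> (\<lambda>i. i - 1)) {1..CARD('n)} UNIV"
    by (rule bij_betw_trans) (rule bij_betw_nth, simp_all add: xs len)
  then have "bij_betw e {1..CARD('n)} UNIV"
    by (rule bij_betw_cong[THEN iffD1, rotated]) (simp add: e_def)
  then have "e \<in> enumerations" by (simp add: enumerations_def e_def)
  moreover have "h (e j) \<le> h (e i)" if "1 \<le> i" "i \<le> j" "j \<le> CARD('n)" for i j
    using that sorted_rev_nth_mono[OF sorted, of "i - 1" "j - 1"] by (simp add: e_def len)
  ultimately show thesis using that by blast
qed

text \<open>The positions whose value reaches the threshold are closed under passing to smaller
  positions, so the largest one is the required \<open>k\<close>; \<open>k = 0\<close> covers the
  empty superlevel set.\<close>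

lemma superlevel_set_descending_enumeration:
  fixes h :: "'n::finite \<Rightarrow> 'a::linorder"
  assumes e: "e \<in> enumerations"
    and desc: "\<And>i j. 1 \<le> i \<Longrightarrow> i \<le> j \<Longrightarrow> j \<le> CARD('n) \<Longrightarrow> h (e j) \<le> h (e i)"
  shows "\<exists>k \<le> CARD('n). {x. t \<le> h x} = e ` {1..k}"
proof -
  define J where "J = {j \<in> {1..CARD('n)}. t \<le> h (e j)}"
  have "{x. t \<le> h x} = e ` J"
  proof -
    have "e ` J = {x \<in> e ` {1..CARD('n)}. t \<le> h x}" unfolding J_def by blast
    then show ?thesis using bij_betw_imp_surj_on[OF enumerationsD[OF e]] by simp
  qed
  moreover have "\<exists>k \<le> CARD('n). J = {1..k}"
  proof (cases "J = {}")
    case True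
    then show ?thesis by (intro exI[of _ 0]) auto
  next
    case False
    have "finite J" by (simp add: J_def)
    then have Max: "Max J \<in> J" "\<And>j. j \<in> J \<Longrightarrow> j \<le> Max J" using False by auto
    obtain k where k: "k \<in> J" "\<And>j. j \<in> J \<Longrightarrow> j \<le> k" using Max by blast
    have "{1..k} \<subseteq> J"
    proof
      fix j assume "j \<in> {1..k}"
      then show "j \<in> J" using k(1) desc[of j k] by (auto simp: J_def)
    qed
    moreover have "J \<subseteq> {1..k}"
    proof
      fix j assume "j \<in> J"
      then show "j \<in> {1..k}" using k(2)[of j] by (simp add: J_def)
    qed
    ultimately have "J = {1..k}" by (rule equalityI[rotated])
    moreover have "k \<le> CARD('n)" using k(1) by (simp add: J_def)
    ultimately show ?thesis by blast
  qed
  ultimately show ?thesis by blast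
qed

text \<open>The largest element of a set of \<open>k\<close> positive integers is at least
  \<open>k\<close>, so its factor is at most \<open>g k\<close>. Removing it allows
  induction.\<close>

lemma prod_le_prod_initial_segment:
  fixes g :: "nat \<Rightarrow> real"
  assumes nonneg: "\<And>i. 0 \<le> g i"
    and desc: "\<And>i j. 1 \<le> i \<Longrightarrow> i \<le> j \<Longrightarrow> j \<le> n \<Longrightarrow> g j \<le> g i"
    and "S \<subseteq> {1..n}" "card S = k"
  shows "prod g S \<le> prod g {1..k}"
  using assms(3,4)
proof (induction k arbitrary: S)
  case 0
  then have "S = {}" using finite_subset by fastforce
  then show ?case by simp
next
  case (Suc k)
  have fin: "finite S" using Suc.prems(1) finite_subset by blast
  have "S \<noteq> {}" using Suc.prems by auto
  then have M: "Max S \<in> S" using fin by simp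
  have "S \<subseteq> {1..Max S}" using fin Suc.prems(1) by auto
  then have "Suc k \<le> Max S" using card_mono[of "{1..Max S}" S] Suc.prems(2) by simp
  then have "g (Max S) \<le> g (Suc k)" using M Suc.prems(1) by (intro desc) auto
  moreover have "prod g (S - {Max S}) \<le> prod g {1..k}"
    using Suc.prems M fin by (intro Suc.IH) auto
  ultimately have "g (Max S) * prod g (S - {Max S}) \<le> g (Suc k) * prod g {1..k}"
    by (intro mult_mono nonneg prod_nonneg)
  then show ?case using prod.remove[OF fin M, of g] by (simp add: mult.commute)
qed

lemma enumeration_prod_le_mu:
  assumes "\<sigma> \<in> enumerations"
  shows "(\<Prod>i=1..k. cmod (z $ \<sigma> i)) \<le> mu k z"
  unfolding mu_def prod_norm using assms by (intro Max_ge) auto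

text \<open>With the moduli sorted in descending order, the first \<open>k\<close> of them give the
  largest product of \<open>k\<close> coordinates.\<close>

lemma mu_le_descending_prod:
  fixes v :: "complex ^ 'n::finite"
  assumes f: "f \<in> enumerations"
    and desc: "\<And>i j. 1 \<le> i \<Longrightarrow> i \<le> j \<Longrightarrow> j \<le> CARD('n) \<Longrightarrow> cmod (v $ f j) \<le> cmod (v $ f i)"
    and k: "k \<le> CARD('n)"
  shows "mu k v \<le> (\<Prod>i=1..k. cmod (v $ f i))"
proof -
  have "cmod (\<Prod>i=1..k. v $ \<sigma> i) \<le> (\<Prod>i=1..k. cmod (v $ f i))" if "\<sigma> \<in> enumerations" for \<sigma>
  proof -
    let ?T = "\<sigma> ` {1..k}"
    \<comment> \<open>The positions at which \<open>f\<close> lists the coordinates chosen by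
      \<open>\<sigma>\<close>: the product becomes one over \<open>k\<close> positions of a
      descending sequence.\<close>
    define S where "S = {j \<in> {1..CARD('n)}. f j \<in> ?T}"
    note bf = enumerationsD[OF f] and bs = enumerationsD[OF that]
    have inj\<sigma>: "inj_on \<sigma> {1..k}"
      using bs k by (auto simp: bij_betw_def intro: inj_on_subset)
    have injf: "inj_on f S" using bf by (auto simp: bij_betw_def S_def intro: inj_on_subset)
    have fS: "f ` S = ?T"
    proof -
      have "f ` S = f ` {1..CARD('n)} \<inter> ?T" unfolding S_def by blast
      then show ?thesis using bij_betw_imp_surj_on[OF bf] by simp
    qed
    have "card S = k" using card_image[OF injf] card_image[OF inj\<sigma>] fS by simp
    have "cmod (\<Prod>i=1..k. v $ \<sigma> i) = (\<Prod>x\<in>?T. cmod (v $ x))"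
      unfolding prod.reindex[OF inj\<sigma>] by (simp flip: prod_norm)
    also have "\<dots> = (\<Prod>j\<in>S. cmod (v $ f j))"
      unfolding fS[symmetric] prod.reindex[OF injf] by simp
    also have "\<dots> \<le> (\<Prod>j=1..k. cmod (v $ f j))"
      using \<open>card S = k\<close> desc by (intro prod_le_prod_initial_segment[where n = "CARD('n)"]) (auto simp: S_def)
    finally show ?thesis .
  qed
  then show ?thesis unfolding mu_def using f by (subst Max_le_iff) auto
qed

text \<open>Layer-cake formula: \<open>\<alpha> x\<close> counts the heights \<open>t\<close> from 1
  to \<open>d\<close> with \<open>t \<le> \<alpha> x\<close>; exchanging the two products then gives
  the claim.\<close>

lemma prod_power_superlevel_sets:
  fixes y :: "'n::finite \<Rightarrow> real"
  assumes "\<alpha> \<in> exponent_box d"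
  shows "(\<Prod>x\<in>UNIV. y x ^ \<alpha> x) = (\<Prod>t=1..d. \<Prod>x | t \<le> \<alpha> x. y x)"
proof -
  have "y x ^ \<alpha> x = (\<Prod>t=1..d. if t \<le> \<alpha> x then y x else 1)" for x
  proof -
    have "{1..d} \<inter> {t. t \<le> \<alpha> x} = {1..\<alpha> x}" using assms by (auto simp: exponent_box_def) (meson order_trans)
    then show ?thesis by (simp add: prod.If_cases)
  qed
  then have "(\<Prod>x\<in>UNIV. y x ^ \<alpha> x) = (\<Prod>x\<in>UNIV. \<Prod>t=1..d. if t \<le> \<alpha> x then y x else 1)"
    by simp
  also have "\<dots> = (\<Prod>t=1..d. \<Prod>x\<in>UNIV. if t \<le> \<alpha> x then y x else 1)" by (rule prod.swap)
  also have "\<dots> = (\<Prod>t=1..d. \<Prod>x | t \<le> \<alpha> x. y x)"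
    by (simp add: prod.If_cases)
  finally show ?thesis .
qed

text \<open>The permutation depends on \<open>\<alpha>\<close>: it gives the largest modulus of
  \<open>v\<close> the largest exponent. Each superlevel set of \<open>\<alpha>\<close> then carries
  the \<open>k\<close> largest moduli of \<open>v\<close>, and the layers are compared one by one
  through \<open>mu k\<close>.\<close>

lemma monomial_le_rearranged_monomial:
  fixes z v :: "complex ^ 'n::finite"
  assumes mu: "\<And>k. k \<in> {1..CARD('n)} \<Longrightarrow> mu k z \<le> mu k v"
  obtains \<sigma> where "\<sigma> permutes UNIV"
    "cmod (monomial_at \<alpha> z) \<le> cmod (monomial_at \<alpha> (\<chi> i. v $ \<sigma> i))"
proof -
  obtain e where e: "e \<in> enumerations"
    and e_desc: "\<And>i j. 1 \<le> i \<Longrightarrow> i \<le> j \<Longrightarrow> j \<le> CARD('n) \<Longrightarrow> \<alpha> (e j) \<le> \<alpha> (e i)"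
    using descending_enumeration[of \<alpha>] by blast
  obtain f where f: "f \<in> enumerations"
    and f_desc: "\<And>i j. 1 \<le> i \<Longrightarrow> i \<le> j \<Longrightarrow> j \<le> CARD('n) \<Longrightarrow> cmod (v $ f j) \<le> cmod (v $ f i)"
    using descending_enumeration[of "\<lambda>x. cmod (v $ x)"] by blast
  obtain d where d: "\<alpha> \<in> exponent_box d" using finite_subset_exponent_box[of "{\<alpha>}"] by auto
  note be = enumerationsD[OF e]
  \<comment> \<open>Matches ranks: the \<open>i\<close>-th coordinate in the order of
    \<open>\<alpha>\<close> goes to the \<open>i\<close>-th in the order of the moduli of
    \<open>v\<close>.\<close>
  define \<sigma> where "\<sigma> = f \<circ> inv_into {1..CARD('n)} e"
  have "bij_betw \<sigma> UNIV UNIV"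
    unfolding \<sigma>_def by (rule bij_betw_trans[OF bij_betw_inv_into[OF be] enumerationsD[OF f]])
  then have perm: "\<sigma> permutes UNIV" using bij_imp_permutes[of \<sigma> UNIV] by simp
  have \<sigma>e: "\<sigma> (e i) = f i" if "i \<in> {1..CARD('n)}" for i
    using that be by (simp add: \<sigma>_def bij_betw_def)
  have level: "(\<Prod>x | t \<le> \<alpha> x. cmod (z $ x)) \<le> (\<Prod>x | t \<le> \<alpha> x. cmod (v $ \<sigma> x))" for t
  proof -
    obtain k where k: "k \<le> CARD('n)" "{x. t \<le> \<alpha> x} = e ` {1..k}"
      using superlevel_set_descending_enumeration[of e \<alpha> t, OF e e_desc] by blast
    have inj: "inj_on e {1..k}" using be k by (auto simp: bij_betw_def intro: inj_on_subset)
    have "(\<Prod>i=1..k. cmod (z $ e i)) \<le> (\<Prod>i=1..k. cmod (v $ f i))"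
    \<comment> \<open>The hypothesis starts at \<open>k = 1\<close>; for \<open>k = 0\<close> both
      products are empty.\<close>
    proof (cases "k = 0")
      case False
      have "(\<Prod>i=1..k. cmod (z $ e i)) \<le> mu k z" by (rule enumeration_prod_le_mu[OF e])
      also have "\<dots> \<le> mu k v" using False k by (intro mu) auto
      also have "\<dots> \<le> (\<Prod>i=1..k. cmod (v $ f i))"
        by (rule mu_le_descending_prod[OF f f_desc k(1)])
      finally show ?thesis .
    qed simp
    also have "\<dots> = (\<Prod>i=1..k. cmod (v $ \<sigma> (e i)))"
      using k by (intro prod.cong) (auto simp: \<sigma>e)
    finally show ?thesis unfolding k prod.reindex[OF inj] by simp
  qed
  have "cmod (monomial_at \<alpha> z) \<le> cmod (monomial_at \<alpha> (\<chi> i. v $ \<sigma> i))"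
    unfolding norm_monomial_at prod_power_superlevel_sets[OF d]
    by (intro prod_mono) (auto intro: level prod_nonneg)
  with perm show thesis by (rule that)
qed

section \<open>Linear automorphisms of the polydisc\<close>

lemma monomial_matrix_eq:
  "(\<chi> i j. if i = \<sigma> j then 1 else 0) ** (\<chi> i j. if i = j then t i else 0)
     = (\<chi> i j. if i = \<sigma> j then t j else (0 :: complex))"
proof -
  have "(\<Sum>k\<in>UNIV. (if i = \<sigma> k then 1 else 0) * (if k = j then t k else 0))
      = (if i = \<sigma> j then t j else 0)" for i j
  proof -
    have "(\<Sum>k\<in>UNIV. (if i = \<sigma> k then 1 else 0) * (if k = j then t k else 0))
        = (\<Sum>k\<in>UNIV. if k = j then (if i = \<sigma> j then t j else 0) else 0)"
      by (intro sum.cong) auto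
    then show ?thesis by simp
  qed
  then show ?thesis by (simp add: matrix_matrix_mult_def vec_eq_iff)
qed

lemma monomial_matrix_mult_vector:
  assumes "\<sigma> permutes UNIV"
  shows "((\<chi> i j. if i = \<sigma> j then t j else (0 :: complex)) *v z) $ \<sigma> j = t j * z $ j"
proof -
  have "((\<chi> i j. if i = \<sigma> j then t j else 0) *v z) $ \<sigma> j = (\<Sum>k\<in>UNIV. (if \<sigma> j = \<sigma> k then t k else 0) * z $ k)"
    by (simp add: matrix_vector_mult_def)
  also have "\<dots> = (\<Sum>k\<in>UNIV. if k = j then t j * z $ j else 0)"
    using permutes_inj[OF assms] by (intro sum.cong) (auto dest: injD)
  finally show ?thesis by simp
qed

text \<open>A point of polyradius \<open>r < 1\<close> whose phases cancel those of row
  \<open>i\<close> is mapped to a point with \<open>i\<close>-th coordinate \<open>r\<close> times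
  the row sum. Letting \<open>r\<close> tend to 1 gives the bound.\<close>

lemma Aut0_polydisc_row_sum_le_1:
  fixes A :: "complex ^ 'n ^ 'n"
  assumes "A \<in> Aut0_polydisc"
  shows "(\<Sum>j\<in>UNIV. cmod (A $ i $ j)) \<le> 1"
proof (rule field_le_mult_one_interval)
  fix r :: real assume r: "0 < r" "r < 1"
  \<comment> \<open>Since \<open>sgn\<close> is 0 at 0, vanishing entries of the row cause no
    trouble.\<close>
  define z :: "complex ^ 'n" where "z = (\<chi> j. of_real r * cnj (sgn (A $ i $ j)))"
  have "z \<in> polydisc" using r by (auto simp: polydisc_def z_def norm_mult norm_sgn)
  then have "A *v z \<in> polydisc" using assms by (auto simp: Aut0_polydisc_def)
  then have "cmod ((A *v z) $ i) < 1" by (simp add: polydisc_def)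
  also have "(A *v z) $ i = of_real (r * (\<Sum>j\<in>UNIV. cmod (A $ i $ j)))"
  proof -
    have "a * cnj (sgn a) = of_real (cmod a)" for a
      by (cases "a = 0") (simp_all add: sgn_eq complex_norm_square[symmetric] power2_eq_square)
    then show ?thesis
      by (simp add: matrix_vector_mult_def z_def sum_distrib_left mult.left_commute)
  qed
  also have "cmod \<dots> = r * (\<Sum>j\<in>UNIV. cmod (A $ i $ j))"
    using r by (simp only: norm_of_real) (simp add: sum_nonneg)
  finally show "r * (\<Sum>j\<in>UNIV. cmod (A $ i $ j)) \<le> 1" by simp
qed

text \<open>Otherwise column \<open>j\<close>, the image of a basis vector, would lie in the
  polydisc; as \<open>A\<close> is injective and maps the polydisc onto itself, so would the basis
  vector.\<close>

lemma Aut0_polydisc_column_entry_ge_1: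
  fixes A :: "complex ^ 'n ^ 'n"
  assumes "A \<in> Aut0_polydisc"
  shows "\<exists>i. 1 \<le> cmod (A $ i $ j)"
proof (rule ccontr)
  assume "\<nexists>i. 1 \<le> cmod (A $ i $ j)"
  then have "A *v axis j 1 \<in> polydisc"
    by (auto simp: polydisc_def matrix_vector_mult_def axis_def not_le if_distrib cong: if_cong)
  then have "A *v axis j 1 \<in> (\<lambda>z. A *v z) ` polydisc"
    using assms by (simp add: Aut0_polydisc_def)
  then obtain z where z: "z \<in> polydisc" "A *v axis j 1 = A *v z" by auto
  have "inj ((*v) A)" using assms by (auto simp: Aut0_polydisc_def intro: inj_matrix_vector_mult)
  then have "z = axis j 1" using z(2) by (auto dest: injD)
  then show False using z(1) by (auto simp: polydisc_def axis_def dest: spec[of _ j])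
qed

lemma Aut0_polydisc_eq_monomial_matrices:
  "(Aut0_polydisc :: (complex ^ 'n ^ 'n) set) =
     {(\<chi> i j. if i = \<sigma> j then t j else 0) | \<sigma> t. \<sigma> permutes UNIV \<and> (\<forall>j. cmod (t j) = 1)}"
  (is "_ = ?M")
proof (intro equalityI subsetI)
  fix A :: "complex ^ 'n ^ 'n" assume A: "A \<in> Aut0_polydisc"
  obtain \<sigma> where \<sigma>: "\<And>j. 1 \<le> cmod (A $ \<sigma> j $ j)"
    using Aut0_polydisc_column_entry_ge_1[OF A] by metis
  have row: "cmod (A $ \<sigma> j $ j) = 1 \<and> (\<forall>k. k \<noteq> j \<longrightarrow> A $ \<sigma> j $ k = 0)" for j
  proof -
    have "cmod (A $ \<sigma> j $ j) + (\<Sum>k\<in>UNIV - {j}. cmod (A $ \<sigma> j $ k)) \<le> 1"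
      using Aut0_polydisc_row_sum_le_1[OF A, of "\<sigma> j"]
      by (simp add: sum.remove[where x = j])
    moreover have nonneg: "0 \<le> (\<Sum>k\<in>UNIV - {j}. cmod (A $ \<sigma> j $ k))" by (simp add: sum_nonneg)
    ultimately have "cmod (A $ \<sigma> j $ j) = 1" "(\<Sum>k\<in>UNIV - {j}. cmod (A $ \<sigma> j $ k)) = 0"
      using \<sigma>[of j] by linarith+
    then show ?thesis by (auto simp: sum_nonneg_eq_0_iff)
  qed
  have "inj \<sigma>"
  proof (rule injI)
    fix j k assume "\<sigma> j = \<sigma> k"
    \<comment> \<open>A row has only one nonzero entry, so two columns cannot share it.\<close>
    then show "j = k" using row[of j] row[of k] by (metis norm_zero zero_neq_one)
  qed
  then have perm: "\<sigma> permutes UNIV"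
    using bij_imp_permutes[of \<sigma> UNIV] by (simp add: bij_def finite_UNIV_inj_surj)
  have "A = (\<chi> i j. if i = \<sigma> j then A $ \<sigma> j $ j else 0)"
  proof -
    have "A $ i $ j = (if i = \<sigma> j then A $ \<sigma> j $ j else 0)" for i j
    proof -
      obtain k where "i = \<sigma> k" using permutes_surj[OF perm] by (metis surjD)
      then show ?thesis using row[of k] by auto
    qed
    then show ?thesis by (simp add: vec_eq_iff)
  qed
  then show "A \<in> ?M" using perm row by (intro CollectI exI[of _ \<sigma>] exI[of _ "\<lambda>j. A $ \<sigma> j $ j"]) auto
next
  fix A :: "complex ^ 'n ^ 'n" assume "A \<in> ?M"
  then obtain \<sigma> t where A: "A = (\<chi> i j. if i = \<sigma> j then t j else 0)"
    and perm: "\<sigma> permutes UNIV" and t: "\<And>j. cmod (t j) = 1" by auto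
  have t0: "t j \<noteq> 0" for j using t[of j] by auto
  have act: "(A *v z) $ \<sigma> j = t j * z $ j" for z j
    unfolding A by (rule monomial_matrix_mult_vector[OF perm])
  have all_iff: "(\<forall>i. P i) \<longleftrightarrow> (\<forall>j. P (\<sigma> j))" for P
    using permutes_surj[OF perm] by (metis surjD)
  \<comment> \<open>Membership passes in both directions, so surjectivity of \<open>A\<close> on the
    whole space will make the image of the polydisc all of it.\<close>
  have mem: "A *v z \<in> polydisc \<longleftrightarrow> z \<in> polydisc" for z
    unfolding polydisc_def mem_Collect_eq
    by (subst all_iff) (simp add: act norm_mult t)
  have inj: "inj ((*v) A)"
  proof (rule injI)
    fix x y assume "A *v x = A *v y"
    then have "t j * x $ j = t j * y $ j" for j using act by metis
    then show "x = y" using t0 by (simp add: vec_eq_iff)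
  qed
  then have "invertible A"
    by (simp add: invertible_left_inverse matrix_left_invertible_injective)
  moreover have "surj ((*v) A)"
    using inj by (simp add: linear_injective_imp_surjective)
  then have "(\<lambda>z. A *v z) ` polydisc = polydisc"
    using mem by (metis (no_types, lifting) image_iff subsetI subset_antisym surjD)
  ultimately show "A \<in> Aut0_polydisc" by (simp add: Aut0_polydisc_def)
qed

lemma Aut0_polydisc_eq_permutation_torus:
  "(Aut0_polydisc :: (complex ^ 'n ^ 'n) set) =
     {P ** D | P D. P \<in> permutation_matrices \<and> D \<in> unitary_torus}"
proof -
  have "{P ** D | P D. P \<in> permutation_matrices \<and> D \<in> unitary_torus} =
    {(\<chi> i j. if i = \<sigma> j then 1 else 0) ** (\<chi> i j. if i = j then t i else 0) :: complex ^ 'n ^ 'n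
      | \<sigma> t. \<sigma> permutes UNIV \<and> (\<forall>j. cmod (t j) = 1)}"
    unfolding permutation_matrices_def unitary_torus_def by blast
  then show ?thesis
    unfolding Aut0_polydisc_eq_monomial_matrices monomial_matrix_eq by simp
qed

text \<open>The torus absorbs all phases, so the orbit is determined by moduli up to permutation.
  Both inclusions for the hull use the orbit in this form.\<close>

lemma mem_Aut0_polydisc_orbit_iff:
  "w \<in> {A *v v | A. A \<in> Aut0_polydisc} \<longleftrightarrow>
     (\<exists>\<sigma>. \<sigma> permutes UNIV \<and> (\<forall>i. cmod (w $ i) = cmod (v $ \<sigma> i)))"
proof
  assume "w \<in> {A *v v | A. A \<in> Aut0_polydisc}"
  then obtain \<sigma> t where perm: "\<sigma> permutes UNIV" and t: "\<And>j. cmod (t j) = 1"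
    and w: "w = (\<chi> i j. if i = \<sigma> j then t j else 0) *v v"
    by (auto simp: Aut0_polydisc_eq_monomial_matrices)
  \<comment> \<open>The matrix moves coordinate \<open>j\<close> to place \<open>\<sigma> j\<close>,
    whence the inverse.\<close>
  have "cmod (w $ i) = cmod (v $ inv \<sigma> i)" for i
    using monomial_matrix_mult_vector[OF perm, of t v "inv \<sigma> i"]
    by (simp add: w permutes_inverses[OF perm] norm_mult t)
  then show "\<exists>\<sigma>. \<sigma> permutes UNIV \<and> (\<forall>i. cmod (w $ i) = cmod (v $ \<sigma> i))"
    using permutes_inv[OF perm] by blast
next
  assume "\<exists>\<sigma>. \<sigma> permutes UNIV \<and> (\<forall>i. cmod (w $ i) = cmod (v $ \<sigma> i))"
  then obtain \<sigma> where perm: "\<sigma> permutes UNIV" and w: "\<And>i. cmod (w $ i) = cmod (v $ \<sigma> i)" by blast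
  let ?\<rho> = "inv \<sigma>"
  \<comment> \<open>Where \<open>v\<close> vanishes, so does the matching coordinate of
    \<open>w\<close>; any unimodular value works there, and 1 is taken.\<close>
  define t where "t j = (if v $ j = 0 then 1 else w $ ?\<rho> j / v $ j)" for j
  have wj: "cmod (w $ ?\<rho> j) = cmod (v $ j)" for j
    by (simp add: w permutes_inverses[OF perm])
  have t: "cmod (t j) = 1" for j using wj[of j] by (simp add: t_def norm_divide)
  have tv: "t j * v $ j = w $ ?\<rho> j" for j using wj[of j] by (auto simp: t_def)
  define A where "A = (\<chi> i j. if i = ?\<rho> j then t j else 0)"
  have "(A *v v) $ i = w $ i" for i
    using monomial_matrix_mult_vector[OF permutes_inv[OF perm], of t v "\<sigma> i"]
    by (simp add: A_def tv permutes_inverses[OF perm])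
  then have "w = A *v v" by (simp add: vec_eq_iff)
  moreover have "A \<in> Aut0_polydisc"
    unfolding Aut0_polydisc_eq_monomial_matrices A_def using permutes_inv[OF perm] t by blast
  ultimately show "w \<in> {A *v v | A. A \<in> Aut0_polydisc}" by blast
qed

section \<open>The polynomial hull of an orbit\<close>

lemma holomorphic_polynomial_iff:
  "holomorphic_polynomial p \<longleftrightarrow>
     (\<exists>A c. finite A \<and> p = (\<lambda>z. \<Sum>\<alpha>\<in>A. c \<alpha> * monomial_at \<alpha> z))"
  by (simp add: holomorphic_polynomial_def monomial_at_def)

text \<open>Without boundedness the real supremum in \<open>polynomial_hull\<close> would not
  dominate the values on the orbit.\<close>

lemma bdd_above_polynomial_on_orbit:
  fixes v :: "complex ^ 'n"
  assumes "holomorphic_polynomial p"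
  shows "bdd_above ((\<lambda>w. cmod (p w)) ` {A *v v | A. A \<in> Aut0_polydisc})"
proof -
  obtain A c where A: "finite A" and p: "p = (\<lambda>z. \<Sum>\<alpha>\<in>A. c \<alpha> * monomial_at \<alpha> z)"
    using assms unfolding holomorphic_polynomial_iff by blast
  define B where "B = (\<Sum>i\<in>UNIV. cmod (v $ i))"
  show ?thesis
  proof (rule bdd_aboveI2)
    fix w assume "w \<in> {A *v v | A. A \<in> Aut0_polydisc}"
    then obtain \<sigma> where w: "\<And>i. cmod (w $ i) = cmod (v $ \<sigma> i)"
      unfolding mem_Aut0_polydisc_orbit_iff by blast
    have wB: "cmod (w $ i) \<le> B" for i
      unfolding w B_def by (intro member_le_sum) auto
    have "cmod (p w) \<le> (\<Sum>\<alpha>\<in>A. cmod (c \<alpha> * monomial_at \<alpha> w))"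
      unfolding p by (rule norm_sum)
    also have "\<dots> \<le> (\<Sum>\<alpha>\<in>A. cmod (c \<alpha>) * (\<Prod>i\<in>UNIV. B ^ \<alpha> i))"
      unfolding norm_mult norm_monomial_at
      by (intro sum_mono mult_left_mono prod_mono) (auto intro: power_mono wB)
    finally show "cmod (p w) \<le> (\<Sum>\<alpha>\<in>A. cmod (c \<alpha>) * (\<Prod>i\<in>UNIV. B ^ \<alpha> i))" .
  qed
qed

text \<open>The test polynomials are squarefree monomials. On the orbit each has the modulus of a
  product of coordinates of \<open>v\<close> along another enumeration.\<close>

lemma mu_le_of_mem_polynomial_hull:
  fixes v z :: "complex ^ 'n"
  assumes z: "z \<in> polynomial_hull {A *v v | A. A \<in> Aut0_polydisc}" (is "z \<in> polynomial_hull ?Q")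
    and k: "k \<in> {1..CARD('n)}"
  shows "mu k z \<le> mu k v"
proof -
  have "cmod (\<Prod>i=1..k. z $ e i) \<le> mu k v" if e: "e \<in> enumerations" for e
  proof -
    let ?p = "\<lambda>w :: complex ^ 'n. \<Prod>i=1..k. w $ e i"
    have inj: "inj_on e {1..k}"
      using enumerationsD[OF e] k by (auto simp: bij_betw_def intro: inj_on_subset)
    have "?p w = monomial_at (\<lambda>i. if i \<in> e ` {1..k} then 1 else 0) w" for w
    proof -
      have "?p w = (\<Prod>x\<in>e ` {1..k}. w $ x)" unfolding prod.reindex[OF inj] by simp
      also have "\<dots> = (\<Prod>x\<in>UNIV. if x \<in> e ` {1..k} then w $ x else 1)"
        by (simp add: prod.If_cases)
      also have "\<dots> = monomial_at (\<lambda>i. if i \<in> e ` {1..k} then 1 else 0) w"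
        unfolding monomial_at_def by (intro prod.cong) auto
      finally show ?thesis .
    qed
    then have poly: "holomorphic_polynomial ?p"
      unfolding holomorphic_polynomial_iff
      by (intro exI[of _ "{\<lambda>i. if i \<in> e ` {1..k} then 1 else 0}"] exI[of _ "\<lambda>_. 1"]) simp
    then have "cmod (?p z) \<le> (SUP w\<in>?Q. cmod (?p w))"
      using z unfolding polynomial_hull_def by blast
    also have "\<dots> \<le> mu k v"
    proof (rule cSUP_least)
      have "v \<in> ?Q" unfolding mem_Aut0_polydisc_orbit_iff using permutes_id by fastforce
      then show "?Q \<noteq> {}" by blast
      fix w assume "w \<in> ?Q"
      then obtain \<sigma> where perm: "\<sigma> permutes UNIV" and w: "\<And>i. cmod (w $ i) = cmod (v $ \<sigma> i)"
        unfolding mem_Aut0_polydisc_orbit_iff by blast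
      \<comment> \<open>Composing with \<open>\<sigma>\<close> loses extensionality, which
        \<open>restrict\<close> restores.\<close>
      define f where "f = restrict (\<sigma> \<circ> e) {1..CARD('n)}"
      have "bij_betw (\<sigma> \<circ> e) {1..CARD('n)} UNIV"
        using enumerationsD[OF e] permutes_bij[OF perm] by (rule bij_betw_trans)
      then have "bij_betw f {1..CARD('n)} UNIV"
        by (rule bij_betw_cong[THEN iffD1, rotated]) (simp add: f_def)
      then have f: "f \<in> enumerations" by (simp add: enumerations_def f_def)
      have "cmod (?p w) = (\<Prod>i=1..k. cmod (v $ f i))"
        unfolding prod_norm[symmetric] using k by (intro prod.cong) (auto simp: f_def w)
      also have "\<dots> \<le> mu k v" by (rule enumeration_prod_le_mu[OF f])
      finally show "cmod (?p w) \<le> mu k v" .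
    qed
    finally show ?thesis .
  qed
  moreover obtain e :: "nat \<Rightarrow> 'n" where "e \<in> enumerations"
    using descending_enumeration[of "\<lambda>_::'n. 0::nat"] by blast
  ultimately show ?thesis unfolding mu_def[of k z] by (subst Max_le_iff) auto
qed

text \<open>Different monomials need different permutations of \<open>v\<close>, so
  \<open>p z\<close> is not compared with one value on the orbit: terms are bounded separately, and
  high powers of \<open>p\<close> make the cost of counting them negligible.\<close>

lemma mem_polynomial_hull_of_mu_le:
  fixes v z :: "complex ^ 'n"
  assumes mu: "\<And>k. k \<in> {1..CARD('n)} \<Longrightarrow> mu k z \<le> mu k v"
  shows "z \<in> polynomial_hull {A *v v | A. A \<in> Aut0_polydisc}" (is "z \<in> polynomial_hull ?Q")
  unfolding polynomial_hull_def
proof (intro CollectI allI impI)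
  fix p :: "complex ^ 'n \<Rightarrow> complex" assume poly: "holomorphic_polynomial p"
  then obtain A c where A: "finite A" and p: "p = (\<lambda>z. \<Sum>\<alpha>\<in>A. c \<alpha> * monomial_at \<alpha> z)"
    unfolding holomorphic_polynomial_iff by blast
  obtain d where d: "A \<subseteq> exponent_box d" using finite_subset_exponent_box[OF A] .
  define M where "M = (SUP w\<in>?Q. cmod (p w))"
  have M: "cmod (p w) \<le> M" if "w \<in> ?Q" for w
    unfolding M_def by (rule cSUP_upper[OF that bdd_above_polynomial_on_orbit[OF poly]])
  have "v \<in> ?Q" unfolding mem_Aut0_polydisc_orbit_iff using permutes_id by fastforce
  then have M0: "M \<ge> 0" using M norm_ge_zero order_trans by blast
  have "cmod (p z) ^ m \<le> real (Suc (d * m)) ^ CARD('n) * M ^ m" for m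
  proof -
    let ?E = "exponent_box (d * m) :: ('n \<Rightarrow> nat) set"
    obtain c' where c': "\<And>w. p w ^ m = (\<Sum>\<alpha>\<in>?E. c' \<alpha> * monomial_at \<alpha> w)"
      using power_polynomial_box[OF A d, of c m] unfolding p by blast
    have "cmod (c' \<alpha> * monomial_at \<alpha> z) \<le> M ^ m" if \<alpha>: "\<alpha> \<in> ?E" for \<alpha>
    proof -
      obtain \<sigma> where perm: "\<sigma> permutes UNIV"
        and le: "cmod (monomial_at \<alpha> z) \<le> cmod (monomial_at \<alpha> (\<chi> i. v $ \<sigma> i))"
        using monomial_le_rearranged_monomial[OF mu] by blast
      have "cmod (c' \<alpha> * monomial_at \<alpha> z) \<le> cmod (c' \<alpha> * monomial_at \<alpha> (\<chi> i. v $ \<sigma> i))"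
        using le by (simp add: norm_mult mult_left_mono)
      also have "\<dots> \<le> M ^ m"
      proof (rule torus_Cauchy_estimate[OF finite_exponent_box \<alpha>])
        fix t :: "'n \<Rightarrow> complex" assume t: "\<And>i. cmod (t i) = 1"
        \<comment> \<open>The whole torus through a permuted \<open>v\<close> lies in the orbit, so
          \<open>M ^ m\<close> bounds \<open>p ^ m\<close> there.\<close>
        have "(\<chi> i. t i * (\<chi> i. v $ \<sigma> i) $ i) \<in> ?Q"
          unfolding mem_Aut0_polydisc_orbit_iff using perm by (auto simp: norm_mult t)
        then show "cmod (\<Sum>\<beta>\<in>?E. c' \<beta> * monomial_at \<beta> (\<chi> i. t i * (\<chi> i. v $ \<sigma> i) $ i)) \<le> M ^ m"
          unfolding c'[symmetric] norm_power by (intro power_mono M) auto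
      qed
      finally show ?thesis .
    qed
    then have "(\<Sum>\<alpha>\<in>?E. cmod (c' \<alpha> * monomial_at \<alpha> z)) \<le> real (card ?E) * M ^ m"
      by (rule sum_bounded_above)
    moreover have "cmod (p z) ^ m \<le> (\<Sum>\<alpha>\<in>?E. cmod (c' \<alpha> * monomial_at \<alpha> z))"
      unfolding norm_power[symmetric] c' by (rule norm_sum)
    ultimately show ?thesis by (simp add: card_exponent_box)
  qed
  then show "cmod (p z) \<le> (SUP w\<in>?Q. cmod (p w))"
    unfolding M_def[symmetric] by (rule le_of_power_le_polynomial_mult_power[OF M0])
qed

theorem proposition3p2:
  fixes v :: "complex ^ 'n"
  shows "(Aut0_polydisc :: (complex ^ 'n ^ 'n) set) =
           {P ** D | P D. P \<in> permutation_matrices \<and> D \<in> unitary_torus}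
       \<and> polynomial_hull {A *v v | A. A \<in> Aut0_polydisc} =
           {z. \<forall>k\<in>{1..CARD('n)}. mu k z \<le> mu k v}"
proof (rule conjI)
  show "(Aut0_polydisc :: (complex ^ 'n ^ 'n) set) =
      {P ** D | P D. P \<in> permutation_matrices \<and> D \<in> unitary_torus}"
    by (rule Aut0_polydisc_eq_permutation_torus)
  show "polynomial_hull {A *v v | A. A \<in> Aut0_polydisc} =
      {z. \<forall>k\<in>{1..CARD('n)}. mu k z \<le> mu k v}"
  proof (intro equalityI subsetI CollectI ballI)
    fix z :: "complex ^ 'n" and k assume "z \<in> polynomial_hull {A *v v | A. A \<in> Aut0_polydisc}" "k \<in> {1..CARD('n)}"
    then show "mu k z \<le> mu k v" by (rule mu_le_of_mem_polynomial_hull)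
  next
    fix z :: "complex ^ 'n" assume "z \<in> {z. \<forall>k\<in>{1..CARD('n)}. mu k z \<le> mu k v}"
    then show "z \<in> polynomial_hull {A *v v | A. A \<in> Aut0_polydisc}"
      by (intro mem_polynomial_hull_of_mu_le) simp
  qed
qed

end
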